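(* Let $N$ be a positive integer, $a,b,c\in\mathbb{R}$ with $a\neq0$, $W=[w_{ij}]\in\mathbb{R}^{N\times N}$ with $w_{ii}=0$ for all $i$, $\Delta=\mathrm{diag}(\delta_1,\dots,\delta_N)$ with $\delta_i\in\{0,1\}$, and $h>0$. Put $\Phi_s=e^{ah}I_N+\frac{c}{a}(e^{ah}-1)W$ and $\Psi_s=\frac{b}{a}(e^{ah}-1)\Delta$, and assume $0$ is not an eigenvalue of $\Phi_s$. Then the discrete-time system $X(k+1)=\Phi_sX(k)+\Psi_sU(k)$ is controllable if and only if the continuous-time system $\dot X(t)=(aI_N+cW)X(t)+b\Delta U(t)$ is controllable.
   Context: The continuous-time system is controllable in the usual sense (equivalently $\mathrm{rank}[sI_N-(aI_N+cW),\ b\Delta]=N$ for all $s\in\mathbb{C}$). The discrete-time system is called controllable if every initial state can be steered to the origin in finitely many steps. *)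

theory Defs
  imports "HOL-Analysis.Analysis"
begin

text \<open>Continuous-time LTI system x'(t) = A x(t) + B u(t): controllable in the usual sense,
  i.e. every state can be transferred to every other state in some finite time T > 0
  by a (continuous) control input.\<close>
definition ct_controllable :: "real^'n^'n \<Rightarrow> real^'m^'n \<Rightarrow> bool" where
  "ct_controllable A B \<longleftrightarrow>
     (\<forall>x0 x1. \<exists>T>0. \<exists>u :: real \<Rightarrow> real^'m. \<exists>x :: real \<Rightarrow> real^'n.
        continuous_on {0..T} u \<and> x 0 = x0 \<and> x T = x1 \<and>
        (\<forall>t\<in>{0..T}. (x has_vector_derivative (A *v x t + B *v u t)) (at t within {0..T})))"

text \<open>State sequence of the discrete-time system X(k+1) = Phi X(k) + Psi U(k), X(0) = x0.\<close>
primrec dt_state :: "real^'n^'n \<Rightarrow> real^'m^'n \<Rightarrow> real^'n \<Rightarrow> (nat \<Rightarrow> real^'m) \<Rightarrow> nat \<Rightarrow> real^'n" where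
  "dt_state Phi Psi x0 U 0 = x0"
| "dt_state Phi Psi x0 U (Suc k) = Phi *v dt_state Phi Psi x0 U k + Psi *v U k"

text \<open>Discrete-time controllability: every initial state can be steered to the origin
  in finitely many steps.\<close>
definition dt_controllable :: "real^'n^'n \<Rightarrow> real^'m^'n \<Rightarrow> bool" where
  "dt_controllable Phi Psi \<longleftrightarrow>
     (\<forall>x0. \<exists>k. \<exists>U. dt_state Phi Psi x0 U k = 0)"

end

theory Submission
  imports Defs "HOL-Real_Asymp.Real_Asymp"
begin

(*
  Both systems are controllable iff the controllable subspace K(A, B), the smallest A-invariant
  subspace containing the range of B, is the whole space. With tau = (e^(ah) - 1) / a, which is
  nonzero, the sampled matrices are Phi_s = I + tau A and Psi_s = tau B, and
  K(I + tau A, tau B) = K(A, B).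

  Discrete time: a state reachable from x0 in k steps differs from Phi^k x0 by an element of K,
  and K is invariant under Phi^-1; conversely, for invertible Phi the null-controllable states
  form a Phi-invariant subspace containing the range of Psi.

  Continuous time: the component y of the state orthogonal to K obeys an input-free linear
  equation, so an energy estimate keeps it at 0 when x(0) = 0. Conversely, for large l,
  x(t) = e^(lt) (lI - A)^-1 B w is a trajectory with input e^(lt) w. A vector (p, q) orthogonal
  to all transfers (x(0), x(1)) makes q . (lI - A)^-1 B w decay like e^-l, and the identity
  y . r = l (y . (lI - A)^-1 r) - y . (lI - A)^-1 A r propagates this decay to all A^k B w,
  forcing q = 0 and then p = 0.
*)

section \<open>Matrices\<close>

lemma matrix_inv_invertible:
  assumes "invertible M"
  shows "M ** matrix_inv M = mat 1" "matrix_inv M ** M = mat 1" "invertible (matrix_inv M)"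
proof -
  show "M ** matrix_inv M = mat 1" "matrix_inv M ** M = mat 1"
    using someI_ex[OF assms[unfolded invertible_def]] by (simp_all add: matrix_inv_def)
  then show "invertible (matrix_inv M)"
    unfolding invertible_def by blast
qed

lemma invariant_subspace_preimage:
  fixes M :: "real^'n^'n"
  assumes "invertible M" "subspace S" "M *v x \<in> S" "\<And>y. y \<in> S \<Longrightarrow> M *v y \<in> S"
  shows "x \<in> S"
proof -
  have inj: "inj ((*v) M)" by (rule inj_matrix_vector_mult[OF assms(1)])
  have "(*v) M ` S = S"
  proof (rule subspace_dim_equal)
    show "subspace ((*v) M ` S)"
      using assms(2) by (rule linear_subspace_image[OF matrix_vector_mul_linear])
    show "(*v) M ` S \<subseteq> S"
      using assms(4) by blast
    show "dim S \<le> dim ((*v) M ` S)"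
      using dim_image_eq[OF matrix_vector_mul_linear, of M S] inj by (simp add: inj_on_subset)
  qed (rule assms(2))
  then have "M *v x \<in> (*v) M ` S"
    using assms(3) by simp
  then show ?thesis
    using inj by (simp add: inj_image_mem_iff)
qed

lemma norm_matrix_vector_le:
  fixes A :: "real^'n^'m"
  shows "norm (A *v x) \<le> onorm ((*v) A) * norm x"
  by (rule onorm[OF matrix_vector_mul_bounded_linear])

lemma onorm_matrix_vector_less_imp_pos:
  fixes A :: "real^'n^'m"
  assumes "onorm ((*v) A) < l"
  shows "0 < l"
  using onorm_pos_le[OF matrix_vector_mul_bounded_linear, of A] assms by linarith

lemma shifted_matrix_vector_mult:
  fixes A :: "real^'n^'n"
  shows "(l *\<^sub>R mat 1 - A) *v v = l *\<^sub>R v - A *v v"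
  by (simp add: matrix_vector_mult_diff_rdistrib scaleR_matrix_vector_assoc[symmetric])

lemma invertible_shifted_matrix:
  fixes A :: "real^'n^'n"
  assumes "onorm ((*v) A) < l"
  shows "invertible (l *\<^sub>R mat 1 - A)"
proof -
  have "v = 0" if "(l *\<^sub>R mat 1 - A) *v v = 0" for v
  proof -
    have "0 < l"
      using assms by (rule onorm_matrix_vector_less_imp_pos)
    moreover have "A *v v = l *\<^sub>R v"
      using that by (simp add: shifted_matrix_vector_mult)
    ultimately have "l * norm v = norm (A *v v)"
      by simp
    also have "\<dots> \<le> onorm ((*v) A) * norm v"
      by (rule norm_matrix_vector_le)
    finally have "(l - onorm ((*v) A)) * norm v \<le> 0"
      by (simp add: algebra_simps)
    then show "v = 0"
      using assms by (simp add: mult_le_0_iff)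
  qed
  then show ?thesis
    by (simp add: invertible_left_inverse matrix_left_invertible_ker)
qed

section \<open>Controllable subspace\<close>

definition controllable_subspace :: "real^'n^'n \<Rightarrow> real^'m^'n \<Rightarrow> (real^'n) set" where
  "controllable_subspace A B = span {(((*v) A) ^^ k) (B *v w) | k w. True}"

lemma subspace_controllable_subspace: "subspace (controllable_subspace A B)"
  by (simp add: controllable_subspace_def)

lemma input_in_controllable_subspace: "B *v w \<in> controllable_subspace A B"
proof -
  have "B *v w = (((*v) A) ^^ 0) (B *v w)"
    by simp
  then show ?thesis
    unfolding controllable_subspace_def by (blast intro: span_base)
qed

lemma controllable_subspace_invariant:
  assumes "x \<in> controllable_subspace A B"
  shows "A *v x \<in> controllable_subspace A B"
proof -
  let ?G = "{(((*v) A) ^^ k) (B *v w) | k w. True}"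
  have "(*v) A ` ?G \<subseteq> ?G"
  proof
    fix y
    assume "y \<in> (*v) A ` ?G"
    then obtain k w where "y = A *v (((*v) A) ^^ k) (B *v w)"
      by blast
    then have "y = (((*v) A) ^^ Suc k) (B *v w)"
      by simp
    then show "y \<in> ?G"
      by blast
  qed
  then have "(*v) A ` span ?G \<subseteq> span ?G"
    by (simp add: span_linear_image[symmetric] span_mono)
  then show ?thesis
    using assms unfolding controllable_subspace_def by blast
qed

lemma controllable_subspace_least:
  assumes "subspace S" "\<And>w. B *v w \<in> S" "\<And>x. x \<in> S \<Longrightarrow> A *v x \<in> S"
  shows "controllable_subspace A B \<subseteq> S"
proof -
  have "(((*v) A) ^^ k) (B *v w) \<in> S" for k w
    by (induction k) (simp_all add: assms)
  then show ?thesis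
    unfolding controllable_subspace_def using assms(1) by (intro span_minimal) auto
qed

lemma controllable_subspace_orthogonal:
  assumes "\<And>k w. y \<bullet> (((*v) A) ^^ k) (B *v w) = 0" and "x \<in> controllable_subspace A B"
  shows "y \<bullet> x = 0"
proof -
  have "orthogonal y x"
  proof (rule orthogonal_to_span)
    show "x \<in> span {(((*v) A) ^^ k) (B *v w) | k w. True}"
      using assms(2) unfolding controllable_subspace_def .
    fix g
    assume "g \<in> {(((*v) A) ^^ k) (B *v w) | k w. True}"
    then show "orthogonal y g"
      using assms(1) by (auto simp: orthogonal_def)
  qed
  then show ?thesis
    by (simp add: orthogonal_def)
qed

lemma controllable_subspace_affine:
  fixes A :: "real^'n^'n" and B :: "real^'m^'n"
  assumes "t \<noteq> 0"
  shows "controllable_subspace (mat 1 + t *\<^sub>R A) (t *\<^sub>R B) = controllable_subspace A B"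
proof
  let ?K = "controllable_subspace A B"
  let ?L = "controllable_subspace (mat 1 + t *\<^sub>R A) (t *\<^sub>R B)"
  show "?L \<subseteq> ?K"
  proof (rule controllable_subspace_least[OF subspace_controllable_subspace])
    have "t *\<^sub>R (B *v w) \<in> ?K" for w
      by (rule subspace_scale[OF subspace_controllable_subspace input_in_controllable_subspace])
    then show "(t *\<^sub>R B) *v w \<in> ?K" for w
      by (simp add: scaleR_matrix_vector_assoc)
    fix x
    assume "x \<in> ?K"
    then have "x + t *\<^sub>R (A *v x) \<in> ?K"
      by (intro subspace_add[OF subspace_controllable_subspace] subspace_scale[OF subspace_controllable_subspace]
          controllable_subspace_invariant)
    then show "(mat 1 + t *\<^sub>R A) *v x \<in> ?K"
      by (simp add: matrix_vector_mult_add_rdistrib scaleR_matrix_vector_assoc[symmetric])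
  qed
  show "?K \<subseteq> ?L"
  proof (rule controllable_subspace_least[OF subspace_controllable_subspace])
    have "(t *\<^sub>R B) *v ((1/t) *\<^sub>R w) \<in> ?L" for w
      by (rule input_in_controllable_subspace)
    then show "B *v w \<in> ?L" for w
      using assms by (simp add: matrix_scaleR_vector_ac[symmetric] scaleR_matrix_vector_assoc[symmetric])
    fix x
    assume "x \<in> ?L"
    then have "(mat 1 + t *\<^sub>R A) *v x - x \<in> ?L"
      by (intro subspace_diff[OF subspace_controllable_subspace] controllable_subspace_invariant)
    then have "(1/t) *\<^sub>R ((mat 1 + t *\<^sub>R A) *v x - x) \<in> ?L"
      by (rule subspace_scale[OF subspace_controllable_subspace])
    then show "A *v x \<in> ?L"
      using assms by (simp add: matrix_vector_mult_add_rdistrib scaleR_matrix_vector_assoc[symmetric])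
  qed
qed

section \<open>Discrete-time systems\<close>

definition null_controllable_states :: "real^'n^'n \<Rightarrow> real^'m^'n \<Rightarrow> (real^'n) set" where
  "null_controllable_states Phi Psi = {x0. \<exists>k U. dt_state Phi Psi x0 U k = 0}"

lemma dt_controllable_iff_null_controllable_states:
  "dt_controllable Phi Psi \<longleftrightarrow> null_controllable_states Phi Psi = UNIV"
  unfolding dt_controllable_def null_controllable_states_def by blast

lemma dt_state_add:
  "dt_state Phi Psi (x + y) (\<lambda>j. U j + V j) k = dt_state Phi Psi x U k + dt_state Phi Psi y V k"
  by (induction k) (simp_all add: algebra_simps)

lemma dt_state_scaleR:
  "dt_state Phi Psi (c *\<^sub>R x) (\<lambda>j. c *\<^sub>R U j) k = c *\<^sub>R dt_state Phi Psi x U k"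
  by (induction k) (simp_all add: algebra_simps)

lemma dt_state_Suc_shift:
  "dt_state Phi Psi x0 U (Suc k) = dt_state Phi Psi (Phi *v x0 + Psi *v U 0) (\<lambda>j. U (Suc j)) k"
  by (induction k) simp_all

lemma dt_state_stays_zero:
  assumes "dt_state Phi Psi x0 U k = 0"
  shows "dt_state Phi Psi x0 (\<lambda>j. if j < k then U j else 0) (k + m) = 0"
proof -
  have "j \<le> k \<Longrightarrow> dt_state Phi Psi x0 (\<lambda>j. if j < k then U j else 0) j = dt_state Phi Psi x0 U j" for j
    by (induction j) auto
  then show ?thesis
    by (induction m) (simp_all add: assms)
qed

lemma dt_state_free_response:
  "dt_state Phi Psi x0 U k - (((*v) Phi) ^^ k) x0 \<in> controllable_subspace Phi Psi"
proof (induction k)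
  case 0
  then show ?case by (simp add: subspace_0[OF subspace_controllable_subspace])
next
  case (Suc k)
  have "dt_state Phi Psi x0 U (Suc k) - (((*v) Phi) ^^ Suc k) x0
        = Phi *v (dt_state Phi Psi x0 U k - (((*v) Phi) ^^ k) x0) + Psi *v U k"
    by (simp add: matrix_vector_mult_diff_distrib)
  also have "\<dots> \<in> controllable_subspace Phi Psi"
    using Suc controllable_subspace_invariant input_in_controllable_subspace
    by (blast intro: subspace_add[OF subspace_controllable_subspace])
  finally show ?case .
qed

lemma subspace_null_controllable_states: "subspace (null_controllable_states Phi Psi)"
  unfolding subspace_def
proof (intro conjI ballI allI)
  let ?N = "null_controllable_states Phi Psi"
  have "dt_state Phi Psi 0 U 0 = 0" for U
    by simp
  then show "0 \<in> ?N"
    unfolding null_controllable_states_def by blast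
  show "x + y \<in> ?N" if xy: "x \<in> ?N" "y \<in> ?N" for x y
  proof -
    obtain k U l V where x0: "dt_state Phi Psi x U k = 0" and y0: "dt_state Phi Psi y V l = 0"
      using xy unfolding null_controllable_states_def by blast
    have "dt_state Phi Psi x (\<lambda>j. if j < k then U j else 0) (k + l) = 0"
      using x0 by (rule dt_state_stays_zero)
    moreover have "dt_state Phi Psi y (\<lambda>j. if j < l then V j else 0) (k + l) = 0"
      using dt_state_stays_zero[OF y0, of k] by (simp only: add.commute)
    ultimately have "dt_state Phi Psi (x + y)
        (\<lambda>j. (if j < k then U j else 0) + (if j < l then V j else 0)) (k + l) = 0"
      by (simp only: dt_state_add add_0)
    then show ?thesis unfolding null_controllable_states_def by blast
  qed
  show "c *\<^sub>R x \<in> ?N" if "x \<in> ?N" for c x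
  proof -
    obtain k U where "dt_state Phi Psi x U k = 0"
      using \<open>x \<in> ?N\<close> unfolding null_controllable_states_def by blast
    then have "dt_state Phi Psi (c *\<^sub>R x) (\<lambda>j. c *\<^sub>R U j) k = 0"
      by (simp add: dt_state_scaleR)
    then show ?thesis unfolding null_controllable_states_def by blast
  qed
qed

lemma controllable_subspace_funpow_preimage:
  fixes Phi :: "real^'n^'n"
  assumes "invertible Phi" "(((*v) Phi) ^^ k) x \<in> controllable_subspace Phi Psi"
  shows "x \<in> controllable_subspace Phi Psi"
  using assms(2)
proof (induction k arbitrary: x)
  case (Suc k)
  have "(((*v) Phi) ^^ k) (Phi *v x) \<in> controllable_subspace Phi Psi"
    using Suc.prems by (simp add: funpow_Suc_right del: funpow.simps)
  then have "Phi *v x \<in> controllable_subspace Phi Psi"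
    by (rule Suc.IH)
  then show ?case
    by (rule invariant_subspace_preimage[OF assms(1) subspace_controllable_subspace])
      (rule controllable_subspace_invariant)
qed simp

lemma controllable_subspace_UNIV_if_dt_controllable:
  fixes Phi :: "real^'n^'n" and Psi :: "real^'m^'n"
  assumes "invertible Phi" "dt_controllable Phi Psi"
  shows "controllable_subspace Phi Psi = UNIV"
proof -
  let ?K = "controllable_subspace Phi Psi"
  have "x0 \<in> ?K" for x0
  proof -
    obtain k U where "dt_state Phi Psi x0 U k = 0"
      using assms(2) unfolding dt_controllable_def by blast
    then have "- (((*v) Phi) ^^ k) x0 \<in> ?K"
      using dt_state_free_response[of Phi Psi x0 U k] by simp
    then have "- (- (((*v) Phi) ^^ k) x0) \<in> ?K"
      by (rule subspace_neg[OF subspace_controllable_subspace])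
    then show ?thesis
      using controllable_subspace_funpow_preimage[OF assms(1), of k x0] by simp
  qed
  then show ?thesis
    by blast
qed

lemma null_controllable_states_invariant:
  fixes Phi :: "real^'n^'n"
  assumes "invertible Phi" "x \<in> null_controllable_states Phi Psi"
  shows "Phi *v x \<in> null_controllable_states Phi Psi"
proof -
  let ?N = "null_controllable_states Phi Psi" and ?Phi' = "matrix_inv Phi"
  \<comment> \<open>Prepending a step with zero input shows that \<open>\<Phi>\<^sup>-\<^sup>1\<close> maps \<open>N\<close> into itself.\<close>
  have preimage_in: "?Phi' *v y \<in> ?N" if "y \<in> ?N" for y
  proof -
    obtain k U where "dt_state Phi Psi y U k = 0"
      using \<open>y \<in> ?N\<close> unfolding null_controllable_states_def by blast
    then have "dt_state Phi Psi (?Phi' *v y) (case_nat 0 U) (Suc k) = 0"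
      by (simp add: dt_state_Suc_shift matrix_vector_mul_assoc matrix_inv_invertible[OF assms(1)]
          del: dt_state.simps)
    then show ?thesis
      unfolding null_controllable_states_def by blast
  qed
  show ?thesis
  proof (rule invariant_subspace_preimage[OF matrix_inv_invertible(3)[OF assms(1)]
        subspace_null_controllable_states])
    show "?Phi' *v (Phi *v x) \<in> ?N"
      using assms(2) by (simp add: matrix_vector_mul_assoc matrix_inv_invertible[OF assms(1)])
  qed (rule preimage_in)
qed

lemma input_in_null_controllable_states:
  fixes Phi :: "real^'n^'n"
  assumes "invertible Phi"
  shows "Psi *v u \<in> null_controllable_states Phi Psi"
proof -
  let ?N = "null_controllable_states Phi Psi" and ?y = "matrix_inv Phi *v - (Psi *v u)"
  have Phi_y: "Phi *v ?y = - (Psi *v u)"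
    by (simp add: matrix_vector_mul_assoc matrix_inv_invertible[OF assms])
  then have "dt_state Phi Psi ?y (\<lambda>_. u) 1 = 0"
    by simp
  then have "?y \<in> ?N"
    unfolding null_controllable_states_def by blast
  then have "Phi *v ?y \<in> ?N"
    by (rule null_controllable_states_invariant[OF assms])
  then have "- (Psi *v u) \<in> ?N"
    by (simp only: Phi_y)
  then have "- (- (Psi *v u)) \<in> ?N"
    by (rule subspace_neg[OF subspace_null_controllable_states])
  then show ?thesis
    by simp
qed

theorem dt_controllable_iff_controllable_subspace:
  fixes Phi :: "real^'n^'n" and Psi :: "real^'m^'n"
  assumes "invertible Phi"
  shows "dt_controllable Phi Psi \<longleftrightarrow> controllable_subspace Phi Psi = UNIV"
proof
  assume "controllable_subspace Phi Psi = UNIV"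
  then have "null_controllable_states Phi Psi = UNIV"
    using controllable_subspace_least[OF subspace_null_controllable_states
        input_in_null_controllable_states[OF assms] null_controllable_states_invariant[OF assms]]
    by blast
  then show "dt_controllable Phi Psi"
    by (simp add: dt_controllable_iff_null_controllable_states)
qed (rule controllable_subspace_UNIV_if_dt_controllable[OF assms])

section \<open>Continuous-time systems\<close>

lemma orthogonal_projection_exists:
  fixes K :: "'a::euclidean_space set"
  assumes "subspace K"
  obtains P where "bounded_linear P" "\<And>x. x - P x \<in> K" "\<And>x k. k \<in> K \<Longrightarrow> P x \<bullet> k = 0"
proof -
  obtain T where T: "pairwise orthogonal T" "span T = K"
    using orthogonal_basis_subspace[OF assms] by blast
  define P where "P x = x - (\<Sum>b\<in>T. (b \<bullet> x / (b \<bullet> b)) *\<^sub>R b)" for x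
  show thesis
  proof
    show "bounded_linear P"
      unfolding P_def[abs_def]
      by (intro bounded_linear_sub bounded_linear_ident bounded_linear_sum
          bounded_linear_compose[OF bounded_linear_scaleR_left]
          bounded_linear_compose[OF bounded_linear_divide] bounded_linear_inner_right)
    show "x - P x \<in> K" for x
    proof -
      have "(\<Sum>b\<in>T. (b \<bullet> x / (b \<bullet> b)) *\<^sub>R b) \<in> span T"
        by (intro span_sum span_mul span_base)
      then show ?thesis
        using T(2) by (simp add: P_def)
    qed
    show "P x \<bullet> k = 0" if "k \<in> K" for x k
      using Gram_Schmidt_step[OF T(1), of k x] that T(2)
      by (simp add: P_def orthogonal_def inner_commute)
  qed
qed

lemma energy_estimate_zero:
  fixes y :: "real \<Rightarrow> 'a::real_inner"
  assumes "0 \<le> T" and "y 0 = 0"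
    and deriv: "\<And>t. t \<in> {0..T} \<Longrightarrow> (y has_vector_derivative y' t) (at t within {0..T})"
    and growth: "\<And>t. t \<in> {0..T} \<Longrightarrow> y t \<bullet> y' t \<le> C * (y t \<bullet> y t)"
  shows "y T = 0"
proof -
  \<comment> \<open>The weighted energy \<open>exp (-2 C t) |y t|\<^sup>2\<close> is nonincreasing and starts at 0.\<close>
  define E where "E t = exp (-2*C*t) * (y t \<bullet> y t)" for t
  define E' where "E' t = 2 * exp (-2*C*t) * (y t \<bullet> y' t - C * (y t \<bullet> y t))" for t
  have dE: "(E has_real_derivative E' t) (at t within {0..T})" if "t \<in> {0..T}" for t
  proof -
    have "((\<lambda>t. y t \<bullet> y t) has_real_derivative 2 * (y t \<bullet> y' t)) (at t within {0..T})"
      using bounded_bilinear.has_vector_derivative[OF bounded_bilinear_inner deriv[OF that] deriv[OF that]]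
      by (simp add: has_real_derivative_iff_has_vector_derivative inner_commute)
    then show ?thesis
      unfolding E_def[abs_def] E'_def by (auto intro!: derivative_eq_intros simp: algebra_simps)
  qed
  have "E T \<le> E 0"
  proof (rule DERIV_nonpos_imp_decreasing_open[OF \<open>0 \<le> T\<close>])
    fix t
    assume t: "0 < t" "t < T"
    then have "(E has_real_derivative E' t) (at t)"
      using dE[of t] by (simp add: at_within_Icc_at)
    moreover have "E' t \<le> 0"
      using growth[of t] t by (simp add: E'_def mult_le_0_iff)
    ultimately show "\<exists>d. (E has_real_derivative d) (at t) \<and> d \<le> 0"
      by blast
  next
    show "continuous_on {0..T} E"
      by (rule DERIV_continuous_on[OF dE])
  qed
  then have "y T \<bullet> y T \<le> 0"
    using \<open>y 0 = 0\<close> by (simp add: E_def mult_le_0_iff)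
  then show ?thesis
    using inner_gt_zero_iff[of "y T"] by linarith
qed

definition ct_trajectory ::
    "real^'n^'n \<Rightarrow> real^'m^'n \<Rightarrow> real \<Rightarrow> (real \<Rightarrow> real^'n) \<Rightarrow> (real \<Rightarrow> real^'m) \<Rightarrow> bool" where
  "ct_trajectory A B T x u \<longleftrightarrow> continuous_on {0..T} u \<and>
     (\<forall>t\<in>{0..T}. (x has_vector_derivative (A *v x t + B *v u t)) (at t within {0..T}))"

lemma ct_controllable_iff_trajectory:
  "ct_controllable A B \<longleftrightarrow> (\<forall>x0 x1. \<exists>T>0. \<exists>x u. ct_trajectory A B T x u \<and> x 0 = x0 \<and> x T = x1)"
  unfolding ct_controllable_def ct_trajectory_def by blast

lemma orthogonal_component_growth_le:
  fixes A :: "real^'n^'n" and B :: "real^'m^'n"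
  assumes P: "bounded_linear P" "\<And>x. x - P x \<in> controllable_subspace A B"
    "\<And>x k. k \<in> controllable_subspace A B \<Longrightarrow> P x \<bullet> k = 0"
  shows "P x \<bullet> P (A *v x + B *v u) \<le> onorm ((*v) A) * (P x \<bullet> P x)"
proof -
  let ?K = "controllable_subspace A B"
  interpret P: bounded_linear P by (rule P(1))
  have "P (B *v u) \<in> ?K"
    using subspace_diff[OF subspace_controllable_subspace
        input_in_controllable_subspace[where w = u] P(2)[of "B *v u"]] by simp
  then have "P (B *v u) = 0"
    using P(3) inner_eq_zero_iff by blast
  then have "P x \<bullet> P (A *v x + B *v u) = P x \<bullet> (A *v x)"
    using P(3)[OF P(2), of x "A *v x"] by (simp add: P.add inner_diff_right)
  also have "\<dots> = P x \<bullet> (A *v P x)"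
    using P(3)[OF controllable_subspace_invariant[OF P(2)], of x x]
    by (simp add: matrix_vector_mult_diff_distrib inner_diff_right)
  also have "\<dots> \<le> norm (P x) * (onorm ((*v) A) * norm (P x))"
    using norm_cauchy_schwarz[of "P x" "A *v P x"] norm_matrix_vector_le[of A "P x"]
    by (meson mult_left_mono norm_ge_zero order_trans)
  also have "\<dots> = onorm ((*v) A) * (P x \<bullet> P x)"
    by (simp add: power2_norm_eq_inner[symmetric] power2_eq_square)
  finally show ?thesis .
qed

lemma controllable_subspace_UNIV_if_ct_controllable:
  fixes A :: "real^'n^'n" and B :: "real^'m^'n"
  assumes "ct_controllable A B"
  shows "controllable_subspace A B = UNIV"
proof -
  let ?K = "controllable_subspace A B"
  obtain P where P: "bounded_linear P" "\<And>x. x - P x \<in> ?K" "\<And>x k. k \<in> ?K \<Longrightarrow> P x \<bullet> k = 0"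
    using orthogonal_projection_exists[OF subspace_controllable_subspace] by blast
  interpret P: bounded_linear P by (rule P(1))
  have "x1 \<in> ?K" for x1
  proof -
    obtain T x u where "T > 0" "ct_trajectory A B T x u" "x 0 = 0" "x T = x1"
      using assms unfolding ct_controllable_iff_trajectory by blast
    \<comment> \<open>The component of the state orthogonal to \<open>K\<close> obeys an input-free linear equation.\<close>
    have "P (x T) = 0"
    proof (rule energy_estimate_zero[where y = "\<lambda>t. P (x t)"])
      show "0 \<le> T" "P (x 0) = 0"
        using \<open>T > 0\<close> \<open>x 0 = 0\<close> by (simp_all add: P.zero)
      show "((\<lambda>t. P (x t)) has_vector_derivative P (A *v x t + B *v u t)) (at t within {0..T})"
        if "t \<in> {0..T}" for t
        using \<open>ct_trajectory A B T x u\<close> that unfolding ct_trajectory_def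
        by (blast intro: P.has_vector_derivative)
      show "P (x t) \<bullet> P (A *v x t + B *v u t) \<le> onorm ((*v) A) * (P (x t) \<bullet> P (x t))" for t
        by (rule orthogonal_component_growth_le[OF P])
    qed
    then show ?thesis
      using P(2)[of x1] \<open>x T = x1\<close> by simp
  qed
  then show ?thesis
    by blast
qed

definition resolvent :: "real^'n^'n \<Rightarrow> real \<Rightarrow> real^'n^'n" where
  "resolvent A l = matrix_inv (l *\<^sub>R mat 1 - A)"

lemma resolvent_right_inverse:
  assumes "onorm ((*v) A) < l"
  shows "l *\<^sub>R (resolvent A l *v r) - A *v (resolvent A l *v r) = r"
proof -
  have "(l *\<^sub>R mat 1 - A) *v (resolvent A l *v r) = r"
    using matrix_inv_invertible(1)[OF invertible_shifted_matrix[OF assms]]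
    by (simp add: matrix_vector_mul_assoc resolvent_def)
  then show ?thesis
    by (simp add: shifted_matrix_vector_mult)
qed

lemma resolvent_left_inverse:
  assumes "onorm ((*v) A) < l"
  shows "l *\<^sub>R (resolvent A l *v r) - resolvent A l *v (A *v r) = r"
proof -
  have "resolvent A l *v ((l *\<^sub>R mat 1 - A) *v r) = r"
    using matrix_inv_invertible(2)[OF invertible_shifted_matrix[OF assms]]
    by (simp add: matrix_vector_mul_assoc resolvent_def)
  then show ?thesis
    by (simp add: shifted_matrix_vector_mult matrix_vector_mult_diff_distrib matrix_vector_mult_scaleR)
qed

lemma norm_resolvent_le:
  assumes "onorm ((*v) A) < l"
  shows "norm (resolvent A l *v r) \<le> norm r / (l - onorm ((*v) A))"
proof -
  let ?v = "resolvent A l *v r" and ?C = "onorm ((*v) A)"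
  have "0 < l"
    using assms by (rule onorm_matrix_vector_less_imp_pos)
  have "l *\<^sub>R ?v = r + A *v ?v"
    using resolvent_right_inverse[OF assms, of r] by (simp add: diff_eq_eq)
  then have "l * norm ?v = norm (r + A *v ?v)"
    using \<open>0 < l\<close> by (metis abs_of_pos norm_scaleR)
  also have "\<dots> \<le> norm r + ?C * norm ?v"
    using norm_triangle_ineq[of r "A *v ?v"] norm_matrix_vector_le[of A ?v] by linarith
  finally have "(l - ?C) * norm ?v \<le> norm r"
    by (simp add: algebra_simps)
  then show ?thesis
    using assms by (simp add: pos_le_divide_eq mult.commute)
qed

lemma abs_inner_resolvent_le:
  assumes "onorm ((*v) A) < l"
  shows "\<bar>y \<bullet> (resolvent A l *v r)\<bar> \<le> norm y * (norm r / (l - onorm ((*v) A)))"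
  using Cauchy_Schwarz_ineq2[of y "resolvent A l *v r"] norm_resolvent_le[OF assms, of r]
  by (meson mult_left_mono norm_ge_zero order_trans)

lemma inner_resolvent_expansion:
  assumes "onorm ((*v) A) < l"
  shows "y \<bullet> r = l * (y \<bullet> (resolvent A l *v r)) - y \<bullet> (resolvent A l *v (A *v r))"
  using arg_cong[OF resolvent_left_inverse[OF assms, of r], of "(\<bullet>) y"]
  by (simp add: inner_diff_right)

lemma inner_eq_0_if_resolvent_decay:
  fixes A :: "real^'n^'n"
  assumes decay: "\<forall>\<^sub>F l in at_top. \<bar>y \<bullet> (resolvent A l *v r)\<bar> \<le> c * (l ^ k / exp l)"
  shows "y \<bullet> r = 0"
proof -
  let ?C = "onorm ((*v) A)"
  \<comment> \<open>In the expansion of \<open>y \<bullet> r\<close>, the first term decays by assumption and the second is \<open>O(1/l)\<close>.\<close>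
  have bound: "\<forall>\<^sub>F l in at_top.
      \<bar>y \<bullet> r\<bar> \<le> c * (l ^ Suc k / exp l) + norm y * norm (A *v r) / (l - ?C)"
    using decay eventually_gt_at_top[of ?C]
  proof eventually_elim
    case (elim l)
    have "0 < l"
      using elim(2) by (rule onorm_matrix_vector_less_imp_pos)
    then have "\<bar>y \<bullet> r\<bar> \<le> l * \<bar>y \<bullet> (resolvent A l *v r)\<bar> + \<bar>y \<bullet> (resolvent A l *v (A *v r))\<bar>"
      using inner_resolvent_expansion[OF elim(2), of y r] abs_triangle_ineq4[of "l * (y \<bullet> (resolvent A l *v r))"]
      by (simp add: abs_mult)
    also have "\<dots> \<le> l * (c * (l ^ k / exp l)) + norm y * (norm (A *v r) / (l - ?C))"
      using elim(1) \<open>0 < l\<close> abs_inner_resolvent_le[OF elim(2)]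
      by (intro add_mono mult_left_mono) auto
    finally show ?case
      by (simp add: field_simps)
  qed
  have "((\<lambda>l. c * (l ^ Suc k / exp l) + d / (l - C')) \<longlongrightarrow> 0) at_top" for d C' :: real
    by real_asymp
  then have "\<bar>y \<bullet> r\<bar> \<le> 0"
    by (rule tendsto_lowerbound[OF _ bound]) simp
  then show ?thesis
    by simp
qed

lemma resolvent_decay_Suc:
  fixes A :: "real^'n^'n"
  assumes decay: "\<forall>\<^sub>F l in at_top. \<bar>y \<bullet> (resolvent A l *v r)\<bar> \<le> c * (l ^ k / exp l)"
  shows "\<forall>\<^sub>F l in at_top. \<bar>y \<bullet> (resolvent A l *v (A *v r))\<bar> \<le> c * (l ^ Suc k / exp l)"
  using decay eventually_gt_at_top[of "onorm ((*v) A)"]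
proof eventually_elim
  case (elim l)
  have "0 < l"
    using elim(2) by (rule onorm_matrix_vector_less_imp_pos)
  have "y \<bullet> (resolvent A l *v (A *v r)) = l * (y \<bullet> (resolvent A l *v r))"
    using inner_resolvent_expansion[OF elim(2), of y r] inner_eq_0_if_resolvent_decay[OF decay]
    by simp
  then have "\<bar>y \<bullet> (resolvent A l *v (A *v r))\<bar> = l * \<bar>y \<bullet> (resolvent A l *v r)\<bar>"
    using \<open>0 < l\<close> by (simp add: abs_mult)
  also have "\<dots> \<le> l * (c * (l ^ k / exp l))"
    using elim(1) \<open>0 < l\<close> by (intro mult_left_mono) auto
  finally show ?case
    by (simp add: field_simps)
qed

lemma orthogonal_controllable_subspace_if_resolvent_decay:
  fixes A :: "real^'n^'n" and B :: "real^'m^'n"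
  assumes decay: "\<And>w. \<exists>c. \<forall>\<^sub>F l in at_top. \<bar>y \<bullet> (resolvent A l *v (B *v w))\<bar> \<le> c / exp l"
    and "x \<in> controllable_subspace A B"
  shows "y \<bullet> x = 0"
proof (rule controllable_subspace_orthogonal[OF _ assms(2)])
  fix k w
  have "\<exists>c. \<forall>\<^sub>F l in at_top. \<bar>y \<bullet> (resolvent A l *v (((*v) A) ^^ k) (B *v w))\<bar> \<le> c * (l ^ k / exp l)"
  proof (induction k)
    case 0
    then show ?case
      using decay[of w] by simp
  next
    case (Suc k)
    then show ?case
      using resolvent_decay_Suc by fastforce
  qed
  then show "y \<bullet> (((*v) A) ^^ k) (B *v w) = 0"
    using inner_eq_0_if_resolvent_decay by blast
qed

lemma ct_trajectory_add:
  assumes "ct_trajectory A B T x u" "ct_trajectory A B T x' u'"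
  shows "ct_trajectory A B T (\<lambda>t. x t + x' t) (\<lambda>t. u t + u' t)"
  using assms unfolding ct_trajectory_def
  by (auto intro!: continuous_on_add derivative_eq_intros simp: algebra_simps)

lemma ct_trajectory_scaleR:
  assumes "ct_trajectory A B T x u"
  shows "ct_trajectory A B T (\<lambda>t. c *\<^sub>R x t) (\<lambda>t. c *\<^sub>R u t)"
  using assms unfolding ct_trajectory_def
  by (auto intro!: continuous_on_scaleR derivative_eq_intros simp: algebra_simps)

lemma ct_trajectory_exp:
  assumes "l *\<^sub>R v - A *v v = B *v w"
  shows "ct_trajectory A B T (\<lambda>t. exp (l * t) *\<^sub>R v) (\<lambda>t. exp (l * t) *\<^sub>R w)"
proof -
  have "A *v v + B *v w = l *\<^sub>R v"
    using assms by (simp add: algebra_simps)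
  then have "A *v (exp (l * t) *\<^sub>R v) + B *v (exp (l * t) *\<^sub>R w) = (l * exp (l * t)) *\<^sub>R v" for t
    by (simp add: matrix_vector_mult_scaleR mult.commute flip: scaleR_add_right)
  then show ?thesis
    unfolding ct_trajectory_def by (auto intro!: continuous_intros derivative_eq_intros)
qed

definition unit_time_transfers :: "real^'n^'n \<Rightarrow> real^'m^'n \<Rightarrow> ((real^'n) \<times> (real^'n)) set" where
  "unit_time_transfers A B = {(x 0, x 1) | x u. ct_trajectory A B 1 x u}"

lemma unit_time_transfersI: "ct_trajectory A B 1 x u \<Longrightarrow> (x 0, x 1) \<in> unit_time_transfers A B"
  unfolding unit_time_transfers_def by blast

lemma subspace_unit_time_transfers: "subspace (unit_time_transfers A B)"
  unfolding subspace_def unit_time_transfers_def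
proof (intro conjI ballI allI)
  have "ct_trajectory A B 1 (\<lambda>_. 0) (\<lambda>_. 0)"
    by (simp add: ct_trajectory_def)
  then show "0 \<in> {(x 0, x 1) | x u. ct_trajectory A B 1 x u}"
    by (force simp: zero_prod_def)
next
  fix p q
  assume "p \<in> {(x 0, x 1) | x u. ct_trajectory A B 1 x u}" "q \<in> {(x 0, x 1) | x u. ct_trajectory A B 1 x u}"
  then show "p + q \<in> {(x 0, x 1) | x u. ct_trajectory A B 1 x u}"
    by (force dest: ct_trajectory_add)
next
  fix c :: real and p
  assume "p \<in> {(x 0, x 1) | x u. ct_trajectory A B 1 x u}"
  then show "c *\<^sub>R p \<in> {(x 0, x 1) | x u. ct_trajectory A B 1 x u}"
    by (force dest: ct_trajectory_scaleR[where c = c])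
qed

lemma exp_trajectory_transfer:
  assumes "onorm ((*v) A) < l"
  shows "(resolvent A l *v (B *v w), exp l *\<^sub>R (resolvent A l *v (B *v w))) \<in> unit_time_transfers A B"
  using unit_time_transfersI[OF ct_trajectory_exp[OF resolvent_right_inverse[OF assms]]] by simp

lemma resolvent_decay_if_orthogonal_exp_transfers:
  fixes A :: "real^'n^'n" and B :: "real^'m^'n"
  assumes orth: "\<And>l. onorm ((*v) A) < l \<Longrightarrow>
      p \<bullet> (resolvent A l *v (B *v w)) + exp l * (q \<bullet> (resolvent A l *v (B *v w))) = 0"
  shows "\<forall>\<^sub>F l in at_top. \<bar>q \<bullet> (resolvent A l *v (B *v w))\<bar> \<le> norm p * norm (B *v w) / exp l"
  using eventually_ge_at_top[of "onorm ((*v) A) + 1"]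
proof eventually_elim
  case (elim l)
  let ?C = "onorm ((*v) A)" and ?v = "resolvent A l *v (B *v w)"
  have l: "?C < l"
    using elim by linarith
  have "p \<bullet> ?v = - (exp l * (q \<bullet> ?v))"
    using orth[OF l] by linarith
  then have "\<bar>q \<bullet> ?v\<bar> * exp l = \<bar>p \<bullet> ?v\<bar>"
    by (simp add: abs_mult mult.commute)
  also have "\<dots> \<le> norm p * (norm (B *v w) / (l - ?C))"
    by (rule abs_inner_resolvent_le[OF l])
  also have "\<dots> \<le> norm p * norm (B *v w)"
    using elim by (intro mult_left_mono) (simp_all add: divide_le_eq mult_le_cancel_left1)
  finally show ?case
    by (simp add: pos_le_divide_eq)
qed

lemma unit_time_transfers_UNIV:
  fixes A :: "real^'n^'n" and B :: "real^'m^'n"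
  assumes K: "controllable_subspace A B = UNIV"
  shows "unit_time_transfers A B = UNIV"
proof (rule ccontr)
  let ?S = "unit_time_transfers A B" and ?R = "\<lambda>l w. resolvent A l *v (B *v w)"
  assume "?S \<noteq> UNIV"
  then have "span ?S \<noteq> UNIV"
    by (simp add: span_eq_iff[THEN iffD2, OF subspace_unit_time_transfers])
  then obtain p q where "(p, q) \<noteq> 0" and pq: "\<forall>s\<in>span ?S. (p, q) \<bullet> s = 0"
    using span_not_UNIV_orthogonal by fastforce
  have orth: "p \<bullet> ?R l w + exp l * (q \<bullet> ?R l w) = 0" if "onorm ((*v) A) < l" for l w
    using pq[rule_format, OF span_base[OF exp_trajectory_transfer[OF that]]] by simp
  have "q \<bullet> q = 0"
    using K orth resolvent_decay_if_orthogonal_exp_transfers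
    by (blast intro: orthogonal_controllable_subspace_if_resolvent_decay)
  then have "q = 0"
    by simp
  have "\<forall>\<^sub>F l in at_top. \<bar>p \<bullet> ?R l w\<bar> \<le> 0 / exp l" for w
    using eventually_gt_at_top[of "onorm ((*v) A)"] by eventually_elim (use orth \<open>q = 0\<close> in simp)
  then have "p \<bullet> p = 0"
    using K by (blast intro: orthogonal_controllable_subspace_if_resolvent_decay)
  with \<open>q = 0\<close> \<open>(p, q) \<noteq> 0\<close> show False
    by (simp add: zero_prod_def)
qed

lemma ct_controllable_if_controllable_subspace_UNIV:
  fixes A :: "real^'n^'n" and B :: "real^'m^'n"
  assumes "controllable_subspace A B = UNIV"
  shows "ct_controllable A B"
  unfolding ct_controllable_iff_trajectory
proof (intro allI)
  fix x0 x1
  have "(x0, x1) \<in> unit_time_transfers A B"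
    using unit_time_transfers_UNIV[OF assms] by simp
  then obtain x u where "ct_trajectory A B 1 x u" "x 0 = x0" "x 1 = x1"
    unfolding unit_time_transfers_def by blast
  then show "\<exists>T>0. \<exists>x u. ct_trajectory A B T x u \<and> x 0 = x0 \<and> x T = x1"
    by (intro exI[of _ 1]) auto
qed

theorem ct_controllable_iff_controllable_subspace:
  fixes A :: "real^'n^'n" and B :: "real^'m^'n"
  shows "ct_controllable A B \<longleftrightarrow> controllable_subspace A B = UNIV"
  using controllable_subspace_UNIV_if_ct_controllable ct_controllable_if_controllable_subspace_UNIV
  by blast

theorem corollary10:
  fixes a b c h :: real
    and W :: "real^'n^'n"
    and \<delta> :: "'n \<Rightarrow> real"
  assumes "a \<noteq> 0"
    and "\<forall>i. W $ i $ i = 0"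
    and "\<forall>i. \<delta> i \<in> {0, 1}"
    and "h > 0"
    and "\<not> (\<exists>v. v \<noteq> 0 \<and>
              (exp (a*h) *\<^sub>R mat 1 + ((c/a) * (exp (a*h) - 1)) *\<^sub>R W) *v v = 0 *\<^sub>R v)"
  shows "dt_controllable
           (exp (a*h) *\<^sub>R mat 1 + ((c/a) * (exp (a*h) - 1)) *\<^sub>R W)
           (((b/a) * (exp (a*h) - 1)) *\<^sub>R (\<chi> i j. if i = j then \<delta> i else 0))
         \<longleftrightarrow> ct_controllable (a *\<^sub>R mat 1 + c *\<^sub>R W) (b *\<^sub>R (\<chi> i j. if i = j then \<delta> i else 0))"
proof -
  \<comment> \<open>Only \<open>\<tau> \<noteq> 0\<close> and the invertibility of \<open>\<Phi>\<^sub>s\<close> matter.\<close>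
  define A where "A = a *\<^sub>R mat 1 + c *\<^sub>R W"
  define B :: "real^'n^'n" where "B = b *\<^sub>R (\<chi> i j. if i = j then \<delta> i else 0)"
  define \<tau> where "\<tau> = (exp (a*h) - 1) / a"
  have "\<tau> \<noteq> 0"
    using assms(1,4) by (simp add: \<tau>_def)
  have Phi: "exp (a*h) *\<^sub>R mat 1 + ((c/a) * (exp (a*h) - 1)) *\<^sub>R W = mat 1 + \<tau> *\<^sub>R A"
    using assms(1) by (simp add: vec_eq_iff A_def \<tau>_def mat_def field_simps)
  have Psi: "((b/a) * (exp (a*h) - 1)) *\<^sub>R (\<chi> i j. if i = j then \<delta> i else 0) = \<tau> *\<^sub>R B"
    by (simp add: B_def \<tau>_def)
  have "invertible (mat 1 + \<tau> *\<^sub>R A)"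
    using assms(5) unfolding Phi by (auto simp: invertible_left_inverse matrix_left_invertible_ker)
  then have "dt_controllable (mat 1 + \<tau> *\<^sub>R A) (\<tau> *\<^sub>R B) \<longleftrightarrow> controllable_subspace A B = UNIV"
    by (simp add: dt_controllable_iff_controllable_subspace controllable_subspace_affine[OF \<open>\<tau> \<noteq> 0\<close>])
  then show ?thesis
    unfolding Phi Psi by (simp add: ct_controllable_iff_controllable_subspace A_def B_def)
qed

end
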